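(* Let $N\ge 2$, let $\alpha_1,\ldots,\alpha_N\in\mathbb Z$ with $\alpha_1>\alpha_2>\cdots>\alpha_N$, and set $$\mathcal U=\{n\in\mathbb Z^N \mid -\alpha_1\le n_1\le-\alpha_2\le n_2\le\cdots\le-\alpha_N\le n_N\},$$ $$\mathcal U^*=\{n\in(\mathbb Z+\tfrac12)^N \mid -\alpha_1\le n_1\le-\alpha_2\le n_2\le\cdots\le-\alpha_N\le n_N\}.$$ Let $D_1,\ldots,D_N>0$ and let $\boldsymbol x=(x_1,\ldots,x_N)$ be the net on $\mathcal U\cup\mathcal U^*$ defined by $$x_k(n)=D_k\prod_{i=1}^{k-1}\left(-n_i-\alpha_k-\tfrac{k-i}{2}+\tfrac12\right)_{1/2}\ \prod_{i=k}^N\left(n_i+\alpha_k+\tfrac{k-i}{2}\right)_{1/2},\qquad k=1,\ldots,N.$$ Then $\boldsymbol x$ is orthogonal if and only if there is $C>0$ such that for all $k=1,\ldots,N$ $$D_k^{-2}=C\prod_{i<k}\left(\alpha_i-\alpha_k+\tfrac{i-k}{2}\right)\prod_{i>k}\left(\alpha_k-\alpha_i+\tfrac{k-i}{2}\right).$$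
   Context: The discrete square root function is $(u)_{1/2}=\Gamma(u+\tfrac12)/\Gamma(u)$ for $u>0$, and $(0)_{1/2}=0$. Write $\Delta_i f(n)=f(n+e_i)-f(n)$, with $e_i$ the $i$-th coordinate vector, and $\boldsymbol f=(1,\ldots,1)$. A discrete net is a Q-net if all its elementary quadrilaterals (with vertices $\boldsymbol x(n),\boldsymbol x(n+e_i),\boldsymbol x(n+e_i+e_j),\boldsymbol x(n+e_j)$) are planar. A net $\boldsymbol x:\mathcal U\cup\mathcal U^*\to\mathbb R^N$, both of whose restrictions to $\mathcal U$ and $\mathcal U^*$ are Q-nets, is called orthogonal if each edge of $\boldsymbol x(\mathcal U)$ is orthogonal to the dual facet of $\boldsymbol x(\mathcal U^* )$. The facet dual to the edge $[\boldsymbol x(n),\boldsymbol x(n+e_i)]$ is spanned by the edges $[\boldsymbol x(n-e_j+\tfrac12\boldsymbol f),\boldsymbol x(n+\tfrac12\boldsymbol f)]$, $j\ne i$, so orthogonality means $$\left\langle\Delta_i\boldsymbol x(n),\Delta_j\boldsymbol x(n-e_j+\tfrac12\boldsymbol f)\right\rangle=0$$ for all $i\neq j$ and all $n\in\mathbb Z^N$ for which all four points $n,\ n+e_i\in\mathcal U$ and $n-e_j+\tfrac12\boldsymbol f,\ n+\tfrac12\boldsymbol f\in\mathcal U^*$ lie in the domain. *)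

theory Defs
  imports "HOL-Analysis.Analysis"
begin

text \<open>
  Coordinates of \<open>\<real>\<^sup>N\<close> are indexed by a finite linearly ordered type \<open>'n\<close> with
  \<open>CARD('n) = N\<close>. Since numerical values of indices enter the formulas,
  \<open>pos k \<in> {1..N}\<close> is the position of \<open>k\<close> in the linear order.
\<close>

definition pos :: "'n::{finite, linorder} \<Rightarrow> nat" where
  "pos k = card {..k}"

lemma pos_less_iff: "pos i < pos j \<longleftrightarrow> i < (j :: 'n::{finite, linorder})"
proof -
  have "pos i < pos j" if "i < j" for i j :: 'n
    unfolding pos_def using that by (intro psubset_card_mono) auto
  then show ?thesis
    by (metis less_asym' linorder_neqE order_less_irrefl)
qed

lemma bij_betw_pos: "bij_betw pos (UNIV :: 'n::{finite, linorder} set) {1..CARD('n)}"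
proof -
  have inj: "inj (pos :: 'n \<Rightarrow> nat)"
    by (metis injI linorder_neqE order_less_irrefl pos_less_iff)
  have sub: "pos ` (UNIV :: 'n set) \<subseteq> {1..CARD('n)}"
    by (auto simp: pos_def Suc_le_eq card_gt_0_iff intro!: card_mono)
  have "pos ` (UNIV :: 'n set) = {1..CARD('n)}"
    by (rule card_subset_eq) (use sub in \<open>simp_all add: card_image[OF inj]\<close>)
  with inj show ?thesis
    by (simp add: bij_betw_def)
qed

text \<open>The value at \<open>u < 0\<close> is a dummy; only \<open>u \<ge> 0\<close> is meaningful.\<close>

definition dsqrt :: "real \<Rightarrow> real" where
  "dsqrt u = (if u > 0 then Gamma (u + 1/2) / Gamma u else 0)"

definition lattice :: "(real^'n) set" where
  "lattice = {n. \<forall>i. n $ i \<in> \<int>}"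

definition half_lattice :: "(real^'n) set" where
  "half_lattice = {n. \<forall>i. n $ i - 1/2 \<in> \<int>}"

text \<open>
  The chain \<open>-\<alpha>\<^sub>1 \<le> n\<^sub>1 \<le> -\<alpha>\<^sub>2 \<le> n\<^sub>2 \<le> \<dots> \<le> -\<alpha>\<^sub>N \<le> n\<^sub>N\<close>.
\<close>

definition interlaced :: "('n::{finite, linorder} \<Rightarrow> int) \<Rightarrow> real^('n::{finite, linorder}) \<Rightarrow> bool" where
  "interlaced \<alpha> n \<longleftrightarrow>
     (\<forall>i. - of_int (\<alpha> i) \<le> n $ i) \<and>
     (\<forall>i j. pos j = pos i + 1 \<longrightarrow> n $ i \<le> - of_int (\<alpha> j))"

definition dom_U :: "('n::{finite, linorder} \<Rightarrow> int) \<Rightarrow> (real^('n::{finite, linorder})) set" where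
  "dom_U \<alpha> = {n \<in> lattice. interlaced \<alpha> n}"

definition dom_Ustar :: "('n::{finite, linorder} \<Rightarrow> int) \<Rightarrow> (real^('n::{finite, linorder})) set" where
  "dom_Ustar \<alpha> = {n \<in> half_lattice. interlaced \<alpha> n}"

abbreviation evec :: "'n::finite \<Rightarrow> real^'n" where
  "evec i \<equiv> axis i 1"

text \<open>The vector \<open>\<^bold>f/2 = (1/2, \<dots>, 1/2)\<close>.\<close>

abbreviation half_f :: "real^'n" where
  "half_f \<equiv> vec (1/2)"

definition fdiff :: "'n::finite \<Rightarrow> (real^'n \<Rightarrow> real^'n) \<Rightarrow> real^'n \<Rightarrow> real^'n" where
  "fdiff i x n = x (n + evec i) - x n"

definition Q_net_on :: "(real^'n) set \<Rightarrow> (real^'n \<Rightarrow> real^'n) \<Rightarrow> bool" where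
  "Q_net_on U x \<longleftrightarrow>
     (\<forall>n i j. i \<noteq> j \<and> {n, n + evec i, n + evec i + evec j, n + evec j} \<subseteq> U \<longrightarrow>
        coplanar {x n, x (n + evec i), x (n + evec i + evec j), x (n + evec j)})"

definition orthogonal_net ::
  "(real^'n) set \<Rightarrow> (real^'n) set \<Rightarrow> (real^'n \<Rightarrow> real^'n) \<Rightarrow> bool" where
  "orthogonal_net U Us x \<longleftrightarrow>
     Q_net_on U x \<and> Q_net_on Us x \<and>
     (\<forall>n i j. n \<in> lattice \<and> i \<noteq> j \<and> {n, n + evec i} \<subseteq> U \<and>
        {n - evec j + half_f, n + half_f} \<subseteq> Us \<longrightarrow>
        orthogonal (fdiff i x n) (fdiff j x (n - evec j + half_f)))"

end

theory Submission
  imports Defs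
begin

text \<open>
  Put \<open>b\<^sub>k = \<alpha>\<^sub>k + k/2\<close> and \<open>y\<^sub>l = n\<^sub>l - l/2\<close>. The identity \<open>(u)\<^sub>1\<^sub>/\<^sub>2 (u + 1/2)\<^sub>1\<^sub>/\<^sub>2 = u\<close> and the resulting
  formula for differences turn the orthogonality condition for the directions \<open>i \<noteq> j\<close> into
  \<open>\<Sum>k. (-1)\<^sup>k D\<^sub>k\<^sup>2 (\<Prod>l\<notin>{i, j}. y\<^sub>l + b\<^sub>k) = 0\<close>. If \<open>(-1)\<^sup>k D\<^sub>k\<^sup>2\<close> is proportional to
  \<open>1 / (\<Prod>l\<noteq>k. b\<^sub>k - b\<^sub>l)\<close>, the sum is a divided difference with \<open>N\<close> nodes of a polynomial of
  degree \<open>N - 2\<close>, hence zero. Conversely, at the corner \<open>n\<^sub>l = -\<alpha>\<^sub>l\<close> the sum for \<open>j = N\<close> has only two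
  nonzero terms, and these tie \<open>D\<^sub>i\<close> to \<open>D\<^sub>N\<close>. Planarity of the quadrilaterals holds for all \<open>D\<close>, by
  \<open>\<Delta>\<^sub>i \<Delta>\<^sub>j x = (\<Delta>\<^sub>i x - \<Delta>\<^sub>j x) / (2 (y\<^sub>j - y\<^sub>i))\<close>.
\<close>

section \<open>The discrete square root\<close>

lemma dsqrt_pos: "dsqrt u > 0" if "u > 0"
  using that by (simp add: dsqrt_def Gamma_real_pos)

text \<open>The Gamma quotients telescope to \<open>Gamma (u + 1) / Gamma u\<close>; at
  \<open>u = 0\<close> the value \<open>dsqrt 0 = 0\<close> fits.\<close>

lemma dsqrt_mult_half: "dsqrt u * dsqrt (u + 1/2) = u" if "u \<ge> 0"
proof (cases "u = 0")
  case False
  with that have u: "u > 0" by simp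
  then have "Gamma (u + 1) = u * Gamma u"
    by (intro Gamma_plus1) (auto simp: nonpos_Ints_def)
  moreover have "Gamma v \<noteq> 0" if "v > 0" for v :: real
    using Gamma_real_pos[OF that] by (rule less_imp_neq[THEN not_sym])
  then have "Gamma u \<noteq> 0" "Gamma (u + 1/2) \<noteq> 0"
    using u by simp_all
  ultimately show ?thesis
    using u by (simp add: dsqrt_def add.assoc)
qed (simp add: dsqrt_def)

text \<open>Subtract the product identity at \<open>u\<close> from the one at
  \<open>u + 1/2\<close>.\<close>

lemma dsqrt_diff_mult_half: "(dsqrt (u + 1) - dsqrt u) * dsqrt (u + 1/2) = 1/2" if "u \<ge> 0"
  using dsqrt_mult_half[of u] dsqrt_mult_half[of "u + 1/2"] that
  by (simp add: algebra_simps)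

text \<open>Both sides become \<open>u\<close> after multiplication by
  \<open>dsqrt (u + 1/2) > 0\<close>.\<close>

lemma dsqrt_diff: "2 * u * (dsqrt (u + 1) - dsqrt u) = dsqrt u" if "u \<ge> 0"
proof -
  have "2 * u * (dsqrt (u + 1) - dsqrt u) * dsqrt (u + 1/2) = dsqrt u * dsqrt (u + 1/2)"
    using dsqrt_mult_half[OF that] dsqrt_diff_mult_half[OF that] by simp
  then show ?thesis
    using dsqrt_pos[of "u + 1/2"] that by simp
qed

text \<open>
  The two kinds of factors of \<open>x\<^sub>k\<close>, for \<open>i \<ge> k\<close> and for \<open>i < k\<close>, become one function of
  \<open>u = n\<^sub>i + \<alpha>\<^sub>k + (k - i)/2\<close>; the reflected one is meaningful for \<open>u \<le> 1/2\<close>.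
\<close>

definition refl_dsqrt :: "bool \<Rightarrow> real \<Rightarrow> real" where
  "refl_dsqrt r u = (if r then dsqrt (1/2 - u) else dsqrt u)"

text \<open>Expresses that the argument handed to \<open>dsqrt\<close> is nonnegative, as the
  identities above require.\<close>

definition refl_ok :: "bool \<Rightarrow> real \<Rightarrow> bool" where
  "refl_ok r u \<longleftrightarrow> (if r then u \<le> 1/2 else u \<ge> 0)"

definition refl_sign :: "bool \<Rightarrow> real" where
  "refl_sign r = (if r then -1 else 1)"

text \<open>The reflected product is \<open>dsqrt (1/2 - u) * dsqrt (- u)\<close>, the identity at
  \<open>- u\<close>; hence the sign.\<close>

lemma refl_dsqrt_mult_half:
  "refl_dsqrt r u * refl_dsqrt r (u + 1/2) = refl_sign r * u"
  if "refl_ok r u" "refl_ok r (u + 1/2)"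
  using dsqrt_mult_half[of u] dsqrt_mult_half[of "- u"] that
  by (auto simp: refl_dsqrt_def refl_ok_def refl_sign_def add.commute mult.commute split: if_splits)

lemma refl_dsqrt_diff_mult_half:
  "(refl_dsqrt r (u + 1) - refl_dsqrt r u) * refl_dsqrt r (u + 1/2) = refl_sign r / 2"
  if "refl_ok r u" "refl_ok r (u + 1)"
proof (cases r)
  case True
  \<comment> \<open>Reflection reverses the step: \<open>u\<close> and \<open>u + 1\<close>
    correspond to \<open>v + 1\<close> and \<open>v\<close>.\<close>
  define v where "v = - u - 1/2"
  have eqs: "1/2 - u = v + 1" "1/2 - (u + 1) = v" "1/2 - (u + 1/2) = v + 1/2"
    by (simp_all add: v_def)
  have "v \<ge> 0" using that True by (simp add: refl_ok_def v_def)
  from dsqrt_diff_mult_half[OF this] True show ?thesis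
    by (simp only: refl_dsqrt_def refl_sign_def if_True eqs) (simp add: left_diff_distrib)
next
  case False
  then show ?thesis
    using dsqrt_diff_mult_half[of u] that
    by (simp add: refl_dsqrt_def refl_ok_def refl_sign_def)
qed

text \<open>In the reflected case \<open>2 * u = - (2 * v) - 1\<close>, and the extra
  \<open>-1\<close> turns \<open>dsqrt v\<close> into \<open>dsqrt (v + 1)\<close>, so no sign
  appears.\<close>

lemma refl_dsqrt_diff:
  "2 * u * (refl_dsqrt r (u + 1) - refl_dsqrt r u) = refl_dsqrt r u"
  if "refl_ok r u" "refl_ok r (u + 1)"
proof (cases r)
  case True
  define v where "v = - u - 1/2"
  have eqs: "1/2 - u = v + 1" "1/2 - (u + 1) = v" "2 * u = - (2 * v) - 1"
    by (simp_all add: v_def)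
  have "v \<ge> 0" using that True by (simp add: refl_ok_def v_def)
  from dsqrt_diff[OF this] True show ?thesis
    by (simp only: refl_dsqrt_def if_True eqs) (simp add: algebra_simps)
next
  case False
  then show ?thesis
    using dsqrt_diff[of u] that by (simp add: refl_dsqrt_def refl_ok_def)
qed

section \<open>Divided differences\<close>

text \<open>The sum is the divided difference of the constant 1. Induction on the number of nodes by
  the recursion \<open>(b a - b c) * S A = S (A - {c}) - S (A - {a})\<close>.\<close>

lemma sum_inverse_node_prod_eq_0:
  fixes b :: "'a \<Rightarrow> 'b::field"
  assumes "finite A" "inj_on b A" "card A \<ge> 2"
  shows "(\<Sum>k\<in>A. 1 / (\<Prod>i\<in>A-{k}. b k - b i)) = 0"
  using assms
proof (induction "card A" arbitrary: A rule: less_induct)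
  case less
  define S where "S B = (\<Sum>k\<in>B. 1 / (\<Prod>i\<in>B-{k}. b k - b i))" for B
  obtain a c where ac: "a \<in> A" "c \<in> A" "a \<noteq> c"
    using less.prems(3) by (metis card_le_Suc0_iff_eq less.prems(1) not_less_eq_eq numeral_2_eq_2)
  have ne: "b k \<noteq> b i" if "k \<in> A" "i \<in> A" "k \<noteq> i" for k i
    using less.prems(2) that by (meson inj_onD)
  \<comment> \<open>The factor \<open>b k - b d\<close> kills the term \<open>k = d\<close> and
    cancels in all others, which deletes the node \<open>d\<close>.\<close>
  have drop: "(\<Sum>k\<in>A. (b k - b d) / (\<Prod>i\<in>A-{k}. b k - b i)) = S (A - {d})" if d: "d \<in> A" for d
  proof -
    have "(b k - b d) / (\<Prod>i\<in>A-{k}. b k - b i) = 1 / (\<Prod>i\<in>A-{d}-{k}. b k - b i)"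
      if "k \<in> A - {d}" for k
    proof -
      have "(\<Prod>i\<in>A-{k}. b k - b i) = (b k - b d) * (\<Prod>i\<in>A-{k}-{d}. b k - b i)"
        using less.prems(1) that d by (intro prod.remove) auto
      moreover have "A - {k} - {d} = A - {d} - {k}" by blast
      ultimately show ?thesis using ne[of k d] that d by simp
    qed
    then show ?thesis
      using d less.prems(1) by (simp add: S_def sum.remove[of A d])
  qed
  have eq: "S (A - {a}) = S (A - {c})"
  \<comment> \<open>With two nodes the induction hypothesis does not apply, but both one-node sums
    equal 1.\<close>
  proof (cases "card A = 2")
    case True
    then have "A = {a, c}"
      using ac less.prems(1) by (metis card_2_iff insert_iff empty_iff insert_commute doubleton_eq_iff)
    then have "A - {a} = {c}" "A - {c} = {a}" using ac by auto
    then show ?thesis by (simp add: S_def)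
  next
    case False
    have "S (A - {d}) = 0" if "d \<in> A" for d
      unfolding S_def using False that less.prems
      by (intro less.hyps) (auto intro: inj_on_subset simp: card_gt_0_iff)
    then show ?thesis using ac by simp
  qed
  have "(b a - b c) * S A = (\<Sum>k\<in>A. (b k - b c) / (\<Prod>i\<in>A-{k}. b k - b i))
      - (\<Sum>k\<in>A. (b k - b a) / (\<Prod>i\<in>A-{k}. b k - b i))"
    by (simp add: S_def sum_distrib_left flip: sum_subtractf diff_divide_distrib)
  also have "\<dots> = 0"
    using drop ac eq by simp
  finally show ?case
    using ne[of a c] ac by (simp add: S_def)
qed

text \<open>
  By induction on \<open>S\<close>, writing \<open>y m + b k = (y m + b a) + (b k - b a)\<close>: the second summand removes
  the node \<open>a\<close>.
\<close>

lemma divided_difference_prod_eq_0: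
  fixes b :: "'a \<Rightarrow> 'b::field"
  assumes "finite S" "finite A" "inj_on b A" "card S + 2 \<le> card A"
  shows "(\<Sum>k\<in>A. (\<Prod>l\<in>S. y l + b k) / (\<Prod>i\<in>A-{k}. b k - b i)) = 0"
  using assms
proof (induction S arbitrary: A rule: finite_induct)
  case empty
  then show ?case
    using sum_inverse_node_prod_eq_0[of A b] by simp
next
  case (insert m S)
  then obtain a where a: "a \<in> A"
    by (metis all_not_in_conv card.empty le_zero_eq add_is_0 zero_neq_numeral)
  have card: "card S + 2 \<le> card (A - {a})"
    using insert a by simp
  have drop: "(b k - b a) * (\<Prod>l\<in>S. y l + b k) / (\<Prod>i\<in>A-{k}. b k - b i)
      = (\<Prod>l\<in>S. y l + b k) / (\<Prod>i\<in>A-{a}-{k}. b k - b i)" if "k \<in> A - {a}" for k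
  proof -
    have "(\<Prod>i\<in>A-{k}. b k - b i) = (b k - b a) * (\<Prod>i\<in>A-{k}-{a}. b k - b i)"
      using insert.prems(1) that a by (intro prod.remove) auto
    moreover have "A - {k} - {a} = A - {a} - {k}" by blast
    moreover have "b k \<noteq> b a"
      using insert.prems(2) that a by (metis DiffD1 DiffD2 inj_onD singletonI)
    ultimately show ?thesis by simp
  qed
  have "(\<Sum>k\<in>A. (\<Prod>l\<in>insert m S. y l + b k) / (\<Prod>i\<in>A-{k}. b k - b i))
      = (\<Sum>k\<in>A. (y m + b a) * ((\<Prod>l\<in>S. y l + b k) / (\<Prod>i\<in>A-{k}. b k - b i))
          + (b k - b a) * (\<Prod>l\<in>S. y l + b k) / (\<Prod>i\<in>A-{k}. b k - b i))"
    using insert.hyps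
    by (intro sum.cong refl) (simp add: ring_distribs add_divide_distrib diff_divide_distrib)
  also have "\<dots> = (y m + b a) * (\<Sum>k\<in>A. (\<Prod>l\<in>S. y l + b k) / (\<Prod>i\<in>A-{k}. b k - b i))
      + (\<Sum>k\<in>A-{a}. (\<Prod>l\<in>S. y l + b k) / (\<Prod>i\<in>A-{a}-{k}. b k - b i))"
    using drop a insert.prems(1)
    by (simp add: sum.distrib sum_distrib_left sum.remove[of A a "\<lambda>k. (b k - b a) * _ k / _ k"])
  also have "\<dots> = 0"
    using insert.IH[of A] insert.IH[of "A - {a}"] insert.prems card
    by (simp add: inj_on_diff insert.hyps)
  finally show ?case .
qed

section \<open>The net\<close>

lemma prod_UNIV_split2:
  fixes g :: "'a::finite \<Rightarrow> 'b::comm_monoid_mult"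
  assumes "i \<noteq> j"
  shows "prod g UNIV = g i * g j * prod g (- {i, j})"
proof -
  have "prod g UNIV = g i * (g j * prod g (UNIV - {i} - {j}))"
    using assms by (simp add: prod.remove[of UNIV i] prod.remove[of "UNIV - {i}" j])
  moreover have "UNIV - {i} - {j} = - {i, j}" by auto
  ultimately show ?thesis by (simp add: mult.assoc)
qed

lemma pos_le_iff: "pos i \<le> pos j \<longleftrightarrow> i \<le> (j :: 'n::{finite, linorder})"
  using pos_less_iff[of j i] by (simp flip: not_less)

lemma pos_Suc_exists:
  fixes i k :: "'n::{finite, linorder}"
  assumes "i < k"
  obtains m :: 'n where "pos m = pos i + 1"
proof -
  have "pos k \<in> {1..CARD('n)}"
    using bij_betwE[OF bij_betw_pos] by blast
  then have "pos i + 1 \<in> {1..CARD('n)}"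
    using assms pos_less_iff[of i k] by simp
  then have "pos i + 1 \<in> pos ` (UNIV :: 'n set)"
    using bij_betw_pos[where 'n = 'n] by (simp add: bij_betw_def)
  then show ?thesis using that by (metis imageE)
qed

locale dsqrt_net =
  fixes \<alpha> :: "'n::{finite, linorder} \<Rightarrow> int"
    and D :: "'n \<Rightarrow> real"
    and x :: "real^('n::{finite, linorder}) \<Rightarrow> real^('n::{finite, linorder})"
  assumes \<alpha>: "\<And>i j. i < j \<Longrightarrow> \<alpha> i > \<alpha> j"
    and D: "\<And>k. D k > 0"
    and x: "\<And>n k. n \<in> dom_U \<alpha> \<union> dom_Ustar \<alpha> \<Longrightarrow>
      x n $ k = D k *
        (\<Prod>i\<in>{..<k}. dsqrt (- n $ i - of_int (\<alpha> k) - (real (pos k) - real (pos i)) / 2 + 1/2)) *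
        (\<Prod>i\<in>{k..}. dsqrt (n $ i + of_int (\<alpha> k) + (real (pos k) - real (pos i)) / 2))"
begin

text \<open>The argument \<open>u\<close> of the factor of \<open>x\<^sub>k\<close> with index
  \<open>l\<close> splits as \<open>shifted n l + node k\<close>; these are the
  \<open>y\<^sub>l\<close> and \<open>b\<^sub>k\<close> of the introduction.\<close>

definition node :: "'n \<Rightarrow> real" where
  "node k = of_int (\<alpha> k) + real (pos k) / 2"

definition shifted :: "real^('n::{finite, linorder}) \<Rightarrow> 'n \<Rightarrow> real" where
  "shifted n l = n $ l - real (pos l) / 2"

text \<open>Each \<open>l < k\<close> contributes one factor -1, so this is
  \<open>(-1) ^ (pos k - 1)\<close>.\<close>

definition node_sign :: "'n \<Rightarrow> real" where
  "node_sign k = (\<Prod>l\<in>UNIV. refl_sign (l < k))"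

section \<open>Shifts, nodes and bounds from the interlacing chain\<close>

lemma shifted_plus_evec: "shifted (n + evec i) l = shifted n l + (if l = i then 1 else 0)"
  by (simp add: shifted_def axis_def)

lemma shifted_dual: "shifted (n - evec j + half_f) l = shifted n l + (if l = j then -1/2 else 1/2)"
  by (simp add: shifted_def axis_def)

text \<open>A strictly decreasing integer sequence drops by at least 1 at each step.\<close>

lemma pos_diff_le: "int (pos j) - int (pos i) \<le> \<alpha> i - \<alpha> j" if "i \<le> j"
  using that
proof (induction "pos j - pos i" arbitrary: i rule: less_induct)
  case less
  show ?case
  proof (cases "i = j")
    case False
    with less.prems have ij: "i < j" by simp
    then obtain m :: 'n where m: "pos m = pos i + 1" by (rule pos_Suc_exists)
    have "pos i < pos j" using ij pos_less_iff by blast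
    then have "m \<le> j" "i < m" "pos j - pos m < pos j - pos i"
      using m pos_le_iff[of m j] pos_less_iff[of i m] by auto
    then show ?thesis
      using less.hyps[of m] \<alpha>[of i m] m by linarith
  qed simp
qed

text \<open>From \<open>i\<close> to \<open>j\<close>, \<alpha> drops by at least
  \<open>pos j - pos i\<close>, while the half positions regain only half of that.\<close>

lemma node_strict_antimono: "node j < node i" if "i < j"
proof -
  have "of_int (int (pos j) - int (pos i)) \<le> (of_int (\<alpha> i - \<alpha> j) :: real)"
    using pos_diff_le[of i j] that by (simp only: of_int_le_iff)
  moreover have "pos i < pos j" using that pos_less_iff by blast
  ultimately show ?thesis by (simp add: node_def)
qed

lemma inj_node: "inj node"
  by (metis injI linorder_neqE node_strict_antimono order_less_irrefl)

lemma interlaced_lower: "n $ l \<ge> - of_int (\<alpha> l)" if "interlaced \<alpha> n"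
  using that by (simp add: interlaced_def)

text \<open>The chain bounds \<open>n $ l\<close> by the successor \<open>m\<close> of
  \<open>l\<close>; from \<open>m\<close> to \<open>k\<close> the integer gaps of \<alpha> add up,
  hence the \<open>- 1\<close>.\<close>

lemma interlaced_upper:
  assumes "interlaced \<alpha> n" "l < k"
  shows "n $ l \<le> - of_int (\<alpha> k) - (real (pos k) - real (pos l) - 1)"
proof -
  have lk: "pos l < pos k" using assms(2) pos_less_iff by blast
  obtain m :: 'n where m: "pos m = pos l + 1"
    using assms(2) by (rule pos_Suc_exists)
  have "m \<le> k" using m lk pos_le_iff[of m k] by simp
  then have "of_int (int (pos k) - int (pos m)) \<le> (of_int (\<alpha> m - \<alpha> k) :: real)"
    using pos_diff_le by (simp only: of_int_le_iff)
  moreover have "n $ l \<le> - of_int (\<alpha> m)"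
    using assms(1) m by (simp add: interlaced_def)
  ultimately show ?thesis using m by simp
qed

text \<open>With \<open>d\<close> the distance of the positions, the bounds give
  \<open>u \<le> 1 - d/2 \<le> 1/2\<close> if \<open>l < k\<close> and
  \<open>u \<ge> d/2 \<ge> 0\<close> otherwise.\<close>

lemma refl_ok_shifted:
  assumes "interlaced \<alpha> n"
  shows "refl_ok (l < k) (shifted n l + node k)"
proof (cases "l < k")
  case True
  then have "pos l + 1 \<le> pos k" using pos_less_iff[of l k] by simp
  then have "real (pos l) + 1 \<le> real (pos k)" by linarith
  with interlaced_upper[OF assms True] True show ?thesis
    by (simp add: refl_ok_def shifted_def node_def)
next
  case False
  then have "of_int (int (pos l) - int (pos k)) \<le> (of_int (\<alpha> k - \<alpha> l) :: real)"
    using pos_diff_le[of k l] by (simp only: of_int_le_iff not_less)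
  moreover have "pos k \<le> pos l"
    using False by (simp add: pos_le_iff)
  ultimately show ?thesis
    using False interlaced_lower[OF assms, of l] by (simp add: refl_ok_def shifted_def node_def)
qed

text \<open>Room for a step in direction \<open>i\<close> forces the gap; it keeps the denominator
  in the planarity formula nonzero.\<close>

lemma shifted_less:
  assumes "interlaced \<alpha> n" "interlaced \<alpha> (n + evec i)" "i < j"
  shows "shifted n i < shifted n j"
proof -
  have "n $ i + 1 \<le> - of_int (\<alpha> j) - (real (pos j) - real (pos i) - 1)"
    using interlaced_upper[OF assms(2,3)] by (simp add: axis_def)
  moreover have "n $ j \<ge> - of_int (\<alpha> j)" using interlaced_lower[OF assms(1)] .
  moreover have "real (pos i) < real (pos j)" using assms(3) by (simp add: pos_less_iff)
  ultimately show ?thesis by (simp add: shifted_def)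
qed

lemma x_eq:
  assumes "n \<in> dom_U \<alpha> \<union> dom_Ustar \<alpha>"
  shows "x n $ k = D k * (\<Prod>l\<in>UNIV. refl_dsqrt (l < k) (shifted n l + node k))"
proof -
  have "(\<Prod>l\<in>UNIV. refl_dsqrt (l < k) (shifted n l + node k))
      = (\<Prod>l\<in>{..<k} \<union> {k..}. refl_dsqrt (l < k) (shifted n l + node k))"
    by (intro prod.cong) auto
  also have "\<dots> = (\<Prod>l\<in>{..<k}. refl_dsqrt (l < k) (shifted n l + node k))
      * (\<Prod>l\<in>{k..}. refl_dsqrt (l < k) (shifted n l + node k))"
    by (intro prod.union_disjoint) auto
  also have "(\<Prod>l\<in>{..<k}. refl_dsqrt (l < k) (shifted n l + node k))
      = (\<Prod>i\<in>{..<k}. dsqrt (- n $ i - of_int (\<alpha> k) - (real (pos k) - real (pos i)) / 2 + 1/2))"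
    by (intro prod.cong refl, simp add: refl_dsqrt_def, intro arg_cong[where f = dsqrt])
      (simp add: shifted_def node_def field_simps)
  also have "(\<Prod>l\<in>{k..}. refl_dsqrt (l < k) (shifted n l + node k))
      = (\<Prod>i\<in>{k..}. dsqrt (n $ i + of_int (\<alpha> k) + (real (pos k) - real (pos i)) / 2))"
    by (intro prod.cong refl, simp add: refl_dsqrt_def flip: not_less, intro arg_cong[where f = dsqrt])
      (simp add: shifted_def node_def field_simps)
  finally show ?thesis using x[OF assms] by simp
qed

section \<open>Planarity of the elementary quadrilaterals\<close>

lemma Q_net_on_x:
  assumes "S \<subseteq> dom_U \<alpha> \<union> dom_Ustar \<alpha>"
  shows "Q_net_on S x"
  unfolding Q_net_on_def
proof (intro allI impI)
  fix n :: "real^('n::{finite, linorder})" and i j :: 'n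
  assume *: "i \<noteq> j \<and> {n, n + evec i, n + evec i + evec j, n + evec j} \<subseteq> S"
  then have dom: "{n, n + evec i, n + evec i + evec j, n + evec j} \<subseteq> dom_U \<alpha> \<union> dom_Ustar \<alpha>"
    and ij: "i \<noteq> j" using assms by auto
  have int: "interlaced \<alpha> n" "interlaced \<alpha> (n + evec i)" "interlaced \<alpha> (n + evec j)"
    using dom by (auto simp: dom_U_def dom_Ustar_def)
  define c where "c = 1 / (2 * (shifted n j - shifted n i))"
  have ne: "shifted n j \<noteq> shifted n i"
    using ij shifted_less[OF int(1,2), of j] shifted_less[OF int(1,3), of i]
    by (metis linorder_neqE order_less_irrefl)
  \<comment> \<open>The formula for the mixed difference, solved for the fourth vertex: the
    coefficients sum to 1 and are the same for every component \<open>k\<close>.\<close>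
  have "x (n + evec i + evec j) = (-1) *\<^sub>R x n + (1 + c) *\<^sub>R x (n + evec i) + (1 - c) *\<^sub>R x (n + evec j)"
  proof (rule vec_eq_iff[THEN iffD2], intro allI)
    fix k
    define f where "f l t = refl_dsqrt (l < k) (shifted n l + t + node k)" for l t
    \<comment> \<open>\<open>R\<close> collects what steps in the directions \<open>i\<close> and
      \<open>j\<close> leave unchanged.\<close>
    define R where "R = D k * (\<Prod>l\<in>-{i,j}. f l 0)"
    have split: "x m $ k = R * f i s * f j t"
      if "m \<in> dom_U \<alpha> \<union> dom_Ustar \<alpha>"
        "\<And>l. shifted m l = shifted n l + (if l = i then s else if l = j then t else 0)" for m s t
      using that ij unfolding x_eq[OF that(1)] prod_UNIV_split2[OF ij]
      by (simp add: R_def f_def)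
    have x0: "x n $ k = R * f i 0 * f j 0"
      using dom by (intro split) auto
    have xi: "x (n + evec i) $ k = R * f i 1 * f j 0"
      using dom by (intro split) (auto simp: shifted_plus_evec)
    have xj: "x (n + evec j) $ k = R * f i 0 * f j 1"
      using dom ij by (intro split) (auto simp: shifted_plus_evec)
    have xij: "x (n + evec i + evec j) $ k = R * f i 1 * f j 1"
      using dom ij by (intro split) (auto simp: shifted_plus_evec)
    have diff: "f l 0 = 2 * (shifted n l + node k) * (f l 1 - f l 0)"
      if "interlaced \<alpha> (n + evec l)" for l
      using refl_dsqrt_diff[of "l < k" "shifted n l + node k"] refl_ok_shifted[OF int(1), of l k]
        refl_ok_shifted[OF that, of l k]
      by (simp add: f_def shifted_plus_evec algebra_simps)
    define dj where "dj = f j 1 - f j 0"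
    define di where "di = f i 1 - f i 0"
    have fi: "f i 0 = 2 * (shifted n i + node k) * di" and fj: "f j 0 = 2 * (shifted n j + node k) * dj"
      using diff int by (simp_all add: di_def dj_def)
    \<comment> \<open>\<open>node k\<close> cancels in the difference, which is why \<open>c\<close>
      can be independent of \<open>k\<close>.\<close>
    have "c * (di * f j 0 - f i 0 * dj) = c * (2 * (shifted n j - shifted n i)) * (di * dj)"
      unfolding fi fj by (simp add: algebra_simps)
    also have "\<dots> = di * dj" using ne by (simp add: c_def)
    finally have "c * (di * f j 0 - f i 0 * dj) = di * dj" .
    then have "R * di * dj = R * (c * (di * f j 0 - f i 0 * dj))" by simp
    then show "x (n + evec i + evec j) $ k
        = ((-1) *\<^sub>R x n + (1 + c) *\<^sub>R x (n + evec i) + (1 - c) *\<^sub>R x (n + evec j)) $ k"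
      by (simp only: vector_add_component vector_scaleR_component x0 xi xj xij)
        (simp add: di_def dj_def algebra_simps)
  qed
  then have "x (n + evec i + evec j) \<in> affine hull {x n, x (n + evec i), x (n + evec j)}"
    unfolding affine_hull_3 by (intro CollectI exI[of _ "-1"] exI[of _ "1 + c"] exI[of _ "1 - c"]) simp
  then have "{x n, x (n + evec i), x (n + evec i + evec j), x (n + evec j)}
      \<subseteq> affine hull {x n, x (n + evec i), x (n + evec j)}"
    by (auto intro: hull_inc)
  then show "coplanar {x n, x (n + evec i), x (n + evec i + evec j), x (n + evec j)}"
    unfolding coplanar_def by blast
qed

section \<open>The inner product of an edge with an edge of its dual facet\<close>

lemma inner_fdiff:
  assumes ij: "i \<noteq> j"
    and U: "{n, n + evec i} \<subseteq> dom_U \<alpha>"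
    and Us: "{n - evec j + half_f, n + half_f} \<subseteq> dom_Ustar \<alpha>"
  shows "fdiff i x n \<bullet> fdiff j x (n - evec j + half_f) =
    (\<Sum>k\<in>UNIV. (D k)\<^sup>2 * node_sign k * (\<Prod>l\<in>-{i,j}. shifted n l + node k)) / 4"
proof -
  have int: "interlaced \<alpha> n" "interlaced \<alpha> (n + evec i)"
    "interlaced \<alpha> (n - evec j + half_f)" "interlaced \<alpha> (n + half_f)"
    using U Us by (auto simp: dom_U_def dom_Ustar_def)
  have sh: "shifted (n + half_f) l = shifted n l + 1/2" for l
    by (simp add: shifted_def)
  \<comment> \<open>Primal and dual factors of equal index differ by a half step. The directions
    \<open>i\<close> and \<open>j\<close> give the difference identity, hence \<open>1/4\<close>;
    every other direction gives the product identity.\<close>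
  have component: "fdiff i x n $ k * fdiff j x (n - evec j + half_f) $ k =
    (D k)\<^sup>2 * node_sign k * (\<Prod>l\<in>-{i,j}. shifted n l + node k) / 4" for k
  proof -
    define f where "f l t = refl_dsqrt (l < k) (shifted n l + t + node k)" for l t
    define s where "s l = refl_sign (l < k)" for l
    have x0: "x n $ k = D k * (f i 0 * f j 0 * (\<Prod>l\<in>-{i,j}. f l 0))"
      using U by (subst x_eq) (auto simp: prod_UNIV_split2[OF ij] f_def)
    have x1: "x (n + evec i) $ k = D k * (f i 1 * f j 0 * (\<Prod>l\<in>-{i,j}. f l 0))"
      using U ij by (subst x_eq) (auto simp: prod_UNIV_split2[OF ij] f_def shifted_plus_evec)
    have x2: "x (n - evec j + half_f) $ k
        = D k * (f i (1/2) * f j (-1/2) * (\<Prod>l\<in>-{i,j}. f l (1/2)))"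
      using Us ij by (subst x_eq) (auto simp: prod_UNIV_split2[OF ij] f_def shifted_dual)
    have x3: "x (n + half_f) $ k = D k * (f i (1/2) * f j (1/2) * (\<Prod>l\<in>-{i,j}. f l (1/2)))"
      using Us by (subst x_eq) (auto simp: prod_UNIV_split2[OF ij] f_def sh)
    have "n - evec j + half_f + evec j = n + half_f" by simp
    then have "fdiff i x n $ k * fdiff j x (n - evec j + half_f) $ k
      = (D k)\<^sup>2 * ((f i 1 - f i 0) * f i (1/2)) * (f j 0 * (f j (1/2) - f j (-1/2)))
        * ((\<Prod>l\<in>-{i,j}. f l 0) * (\<Prod>l\<in>-{i,j}. f l (1/2)))"
      unfolding fdiff_def vector_minus_component
      by (simp only: x0 x1 x2 x3) (simp add: power2_eq_square algebra_simps)
    also have "(f i 1 - f i 0) * f i (1/2) = s i / 2"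
      using refl_dsqrt_diff_mult_half[of "i < k" "shifted n i + node k"]
        refl_ok_shifted[OF int(1), of i k] refl_ok_shifted[OF int(2), of i k]
      by (simp add: f_def s_def shifted_plus_evec algebra_simps)
    also have "f j 0 * (f j (1/2) - f j (-1/2)) = s j / 2"
    proof -
      \<comment> \<open>Chosen so that the dual edge has its ends at \<open>u\<close> and
        \<open>u + 1\<close> and the primal factor sits at the midpoint
        \<open>u + 1/2\<close>.\<close>
      define u where "u = shifted n j - 1/2 + node k"
      have "shifted (n - evec j + half_f) j + node k = u"
        "shifted (n + half_f) j + node k = u + 1"
        by (simp_all only: shifted_dual sh) (simp_all add: u_def)
      then have "refl_ok (j < k) u" "refl_ok (j < k) (u + 1)"
        using refl_ok_shifted[OF int(3), of j k] refl_ok_shifted[OF int(4), of j k] by simp_all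
      moreover have "f j 0 = refl_dsqrt (j < k) (u + 1/2)" "f j (1/2) = refl_dsqrt (j < k) (u + 1)"
        "f j (-1/2) = refl_dsqrt (j < k) u"
        by (simp_all add: f_def u_def algebra_simps)
      ultimately show ?thesis
        using refl_dsqrt_diff_mult_half[of "j < k" u] by (simp add: s_def mult.commute)
    qed
    also have "(\<Prod>l\<in>-{i,j}. f l 0) * (\<Prod>l\<in>-{i,j}. f l (1/2))
        = (\<Prod>l\<in>-{i,j}. s l * (shifted n l + node k))"
      unfolding prod.distrib[symmetric]
    proof (intro prod.cong refl)
      fix l
      show "f l 0 * f l (1/2) = s l * (shifted n l + node k)"
        using refl_dsqrt_mult_half[of "l < k" "shifted n l + node k"]
          refl_ok_shifted[OF int(1), of l k] refl_ok_shifted[OF int(4), of l k]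
        by (simp add: f_def s_def sh algebra_simps)
    qed
    also have "\<dots> = (\<Prod>l\<in>-{i,j}. s l) * (\<Prod>l\<in>-{i,j}. shifted n l + node k)"
      by (rule prod.distrib)
    finally show ?thesis
      by (simp add: node_sign_def prod_UNIV_split2[OF ij] s_def)
  qed
  show ?thesis
    unfolding inner_vec_def inner_real_def component sum_divide_distrib ..
qed

section \<open>The condition on \<open>D\<close> in terms of nodes\<close>

lemma node_prods_eq:
  "(\<Prod>i\<in>{..<k}. of_int (\<alpha> i) - of_int (\<alpha> k) + (real (pos i) - real (pos k)) / 2) *
   (\<Prod>i\<in>{k<..}. of_int (\<alpha> k) - of_int (\<alpha> i) + (real (pos k) - real (pos i)) / 2) =
   node_sign k * (\<Prod>i\<in>UNIV-{k}. node k - node i)"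
proof -
  have "node_sign k = (\<Prod>l\<in>UNIV-{k}. refl_sign (l < k))"
    by (simp add: node_sign_def prod.remove[of UNIV k] refl_sign_def)
  then have "node_sign k * (\<Prod>i\<in>UNIV-{k}. node k - node i)
      = (\<Prod>i\<in>UNIV-{k}. refl_sign (i < k) * (node k - node i))"
    by (simp add: prod.distrib)
  also have "\<dots> = (\<Prod>i\<in>{..<k} \<union> {k<..}. refl_sign (i < k) * (node k - node i))"
    by (intro prod.cong) auto
  also have "\<dots> = (\<Prod>i\<in>{..<k}. refl_sign (i < k) * (node k - node i))
        * (\<Prod>i\<in>{k<..}. refl_sign (i < k) * (node k - node i))"
    by (intro prod.union_disjoint) auto
  also have "(\<Prod>i\<in>{..<k}. refl_sign (i < k) * (node k - node i))
      = (\<Prod>i\<in>{..<k}. of_int (\<alpha> i) - of_int (\<alpha> k) + (real (pos i) - real (pos k)) / 2)"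
    by (intro prod.cong refl) (simp add: refl_sign_def node_def field_simps)
  also have "(\<Prod>i\<in>{k<..}. refl_sign (i < k) * (node k - node i))
      = (\<Prod>i\<in>{k<..}. of_int (\<alpha> k) - of_int (\<alpha> i) + (real (pos k) - real (pos i)) / 2)"
    by (intro prod.cong refl) (auto simp: refl_sign_def node_def field_simps)
  finally show ?thesis by simp
qed

text \<open>The sign flips exactly the negative factors, those with \<open>i < k\<close>. This makes
  the common value of the weights positive.\<close>

lemma node_sign_prod_pos: "node_sign k * (\<Prod>i\<in>UNIV-{k}. node k - node i) > 0"
  unfolding node_prods_eq[symmetric]
  using node_strict_antimono
  by (intro mult_pos_pos prod_pos) (fastforce simp: node_def field_simps)+

lemma powi_condition_iff:
  assumes "C > 0"
  shows "D k powi (-2) = C * (node_sign k * (\<Prod>i\<in>UNIV-{k}. node k - node i)) \<longleftrightarrow>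
    (D k)\<^sup>2 * node_sign k * (\<Prod>i\<in>UNIV-{k}. node k - node i) = 1 / C"
proof -
  have "D k powi (-2) = 1 / (D k)\<^sup>2"
    by (simp add: power_int_def divide_inverse power_inverse)
  show ?thesis
    unfolding \<open>D k powi (-2) = _\<close> using assms D[of k] by (auto simp: field_simps)
qed

section \<open>The two directions of the equivalence\<close>

lemma weights_imp_orthogonal:
  assumes "C > 0"
    and C: "\<And>k. (D k)\<^sup>2 * node_sign k * (\<Prod>i\<in>UNIV-{k}. node k - node i) = 1 / C"
  shows "orthogonal_net (dom_U \<alpha>) (dom_Ustar \<alpha>) x"
  unfolding orthogonal_net_def
proof (intro conjI allI impI)
  fix n :: "real^('n::{finite, linorder})" and i j :: 'n
  assume "n \<in> lattice \<and> i \<noteq> j \<and> {n, n + evec i} \<subseteq> dom_U \<alpha> \<and>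
    {n - evec j + half_f, n + half_f} \<subseteq> dom_Ustar \<alpha>"
  then have *: "i \<noteq> j" "{n, n + evec i} \<subseteq> dom_U \<alpha>"
    "{n - evec j + half_f, n + half_f} \<subseteq> dom_Ustar \<alpha>" by auto
  \<comment> \<open>Turns each coefficient into a constant over the node product, so that the sum
    becomes a divided difference.\<close>
  have w: "(D k)\<^sup>2 * node_sign k * p = 1 / C * (p / (\<Prod>i\<in>UNIV-{k}. node k - node i))" for k p
  proof -
    have "(\<Prod>i\<in>UNIV-{k}. node k - node i) \<noteq> 0"
      using node_sign_prod_pos[of k] by (metis mult_zero_right order_less_irrefl)
    then show ?thesis unfolding C[of k, symmetric] by simp
  qed
  have "card {i, j} \<le> CARD('n)" by (rule card_mono) auto
  then have "card (- {i, j}) + 2 \<le> CARD('n)"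
    using *(1) by (simp add: Compl_eq_Diff_UNIV card_Diff_subset)
  then have "(\<Sum>k\<in>UNIV. (\<Prod>l\<in>-{i,j}. shifted n l + node k) / (\<Prod>i\<in>UNIV-{k}. node k - node i)) = 0"
    by (intro divided_difference_prod_eq_0 inj_node) auto
  then have "fdiff i x n \<bullet> fdiff j x (n - evec j + half_f) = 0"
    unfolding inner_fdiff[OF *] w sum_distrib_left[symmetric] by simp
  then show "orthogonal (fdiff i x n) (fdiff j x (n - evec j + half_f))"
    by (simp add: orthogonal_def)
qed (auto intro: Q_net_on_x)

text \<open>
  The last coordinate of the corner is raised by one so that \<open>n - e\<^sub>N + \<^bold>f/2\<close> stays in \<open>\<U>\<^sup>*\<close>; it is
  the only coordinate that can always be raised further, the gaps of \<open>\<alpha>\<close> possibly being 1.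
\<close>

lemma orthogonal_imp_weights:
  assumes orth: "orthogonal_net (dom_U \<alpha>) (dom_Ustar \<alpha>) x"
  defines "m \<equiv> Max UNIV"
  shows "(D i)\<^sup>2 * node_sign i * (\<Prod>l\<in>UNIV-{i}. node i - node l)
    = (D m)\<^sup>2 * node_sign m * (\<Prod>l\<in>UNIV-{m}. node m - node l)"
proof (cases "i = m")
  case False
  define n :: "real^('n::{finite, linorder})" where "n = (\<chi> l. - of_int (\<alpha> l) + (if l = m then 1 else 0))"
  have le_m: "l \<le> m" for l by (simp add: m_def)
  have gap: "- of_int (\<alpha> a) + 1 \<le> (- of_int (\<alpha> b) :: real)" "a \<noteq> m" if "pos b = pos a + 1" for a b
  proof -
    have ab: "a < b" using that pos_less_iff[of a b] by simp
    then have "\<alpha> b + 1 \<le> \<alpha> a" using \<alpha> by fastforce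
    then have "of_int (\<alpha> b + 1) \<le> (of_int (\<alpha> a) :: real)" by (simp only: of_int_le_iff)
    then show "- of_int (\<alpha> a) + 1 \<le> (- of_int (\<alpha> b) :: real)" by simp
    show "a \<noteq> m" using ab le_m[of b] by auto
  qed
  \<comment> \<open>\<open>d\<close> is the displacement from the corner: between 0 and 1, except
    that the last coordinate has no upper bound.\<close>
  have int: "interlaced \<alpha> n'" if "\<And>l. 0 \<le> d l" "\<And>l. l \<noteq> m \<Longrightarrow> d l \<le> 1"
    "\<And>l. n' $ l = - of_int (\<alpha> l) + d l" for n' d
    unfolding interlaced_def
  proof (intro conjI allI impI)
    fix a b :: 'n assume "pos b = pos a + 1"
    from gap[OF this] that(2)[of a] show "n' $ a \<le> - of_int (\<alpha> b)"
      by (simp add: that(3))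
  qed (use that in simp)
  have U: "{n, n + evec i} \<subseteq> dom_U \<alpha>"
  proof -
    have "interlaced \<alpha> n"
      by (rule int[where d = "\<lambda>l. if l = m then 1 else 0"]) (auto simp: n_def)
    moreover have "interlaced \<alpha> (n + evec i)"
      using False
      by (intro int[where d = "\<lambda>l. if l = m \<or> l = i then 1 else 0"]) (auto simp: n_def axis_def)
    ultimately show ?thesis
      by (auto simp: dom_U_def lattice_def n_def axis_def)
  qed
  have Us: "{n - evec m + half_f, n + half_f} \<subseteq> dom_Ustar \<alpha>"
  proof -
    have "interlaced \<alpha> (n - evec m + half_f)"
      by (rule int[where d = "\<lambda>l. 1/2"]) (auto simp: n_def axis_def)
    moreover have "interlaced \<alpha> (n + half_f)"
      by (rule int[where d = "\<lambda>l. if l = m then 3/2 else 1/2"]) (auto simp: n_def)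
    ultimately show ?thesis
      by (auto simp: dom_Ustar_def half_lattice_def n_def axis_def)
  qed
  have "n \<in> lattice" using U by (simp add: dom_U_def)
  then have "fdiff i x n \<bullet> fdiff m x (n - evec m + half_f) = 0"
    using orth False U Us unfolding orthogonal_net_def orthogonal_def by blast
  then have "0 = (\<Sum>k\<in>UNIV. (D k)\<^sup>2 * node_sign k * (\<Prod>l\<in>-{i,m}. shifted n l + node k))"
    unfolding inner_fdiff[OF False U Us] by simp
  \<comment> \<open>At this point \<open>shifted n l = - node l\<close> for all
    \<open>l \<noteq> m\<close>, and \<open>m\<close> is excluded from the product.\<close>
  also have "\<dots> = (\<Sum>k\<in>UNIV. (D k)\<^sup>2 * node_sign k * (\<Prod>l\<in>-{i,m}. node k - node l))"
    by (intro sum.cong prod.cong arg_cong2[of _ _ _ _ "(*)"] refl)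
      (auto simp: shifted_def n_def node_def)
  also have "\<dots> = (\<Sum>k\<in>{i,m}. (D k)\<^sup>2 * node_sign k * (\<Prod>l\<in>-{i,m}. node k - node l))"
  \<comment> \<open>For \<open>k\<close> other than \<open>i\<close> and \<open>m\<close> the factor
    \<open>l = k\<close> vanishes.\<close>
  proof (intro sum.mono_neutral_right ballI)
    fix k assume k: "k \<in> UNIV - {i, m}"
    then have "(\<Prod>l\<in>-{i,m}. node k - node l) = 0"
      by (intro prod_zero) auto
    then show "(D k)\<^sup>2 * node_sign k * (\<Prod>l\<in>-{i,m}. node k - node l) = 0"
      by simp
  qed auto
  finally have eq: "(D i)\<^sup>2 * node_sign i * (\<Prod>l\<in>-{i,m}. node i - node l)
      = - ((D m)\<^sup>2 * node_sign m * (\<Prod>l\<in>-{i,m}. node m - node l))"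
    using False by simp
  have split: "(\<Prod>l\<in>UNIV-{a}. node a - node l) = (node a - node b) * (\<Prod>l\<in>-{a,b}. node a - node l)"
    if "a \<noteq> b" for a b
  proof -
    have "UNIV - {a} - {b} = - {a, b}" by auto
    then show ?thesis using that by (simp add: prod.remove[of "UNIV - {a}" b])
  qed
  have comm: "-{m,i} = -{i,m}" by auto
  \<comment> \<open>Restoring the missing factor \<open>node i - node m\<close> respectively
    \<open>node m - node i\<close> absorbs the minus sign of \<open>eq\<close>.\<close>
  have "(D i)\<^sup>2 * node_sign i * (\<Prod>l\<in>UNIV-{i}. node i - node l)
      = (node i - node m) * ((D i)\<^sup>2 * node_sign i * (\<Prod>l\<in>-{i,m}. node i - node l))"
    using False by (simp add: split)
  also have "\<dots> = (node m - node i) * ((D m)\<^sup>2 * node_sign m * (\<Prod>l\<in>-{m,i}. node m - node l))"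
    unfolding eq comm by (simp add: algebra_simps)
  also have "\<dots> = (D m)\<^sup>2 * node_sign m * (\<Prod>l\<in>UNIV-{m}. node m - node l)"
    using False by (simp add: split[of m i])
  finally show ?thesis .
qed simp

lemma orthogonal_net_iff:
  "orthogonal_net (dom_U \<alpha>) (dom_Ustar \<alpha>) x \<longleftrightarrow>
    (\<exists>C>0. \<forall>k. (D k)\<^sup>2 * node_sign k * (\<Prod>i\<in>UNIV-{k}. node k - node i) = 1 / C)"
proof
  assume orth: "orthogonal_net (dom_U \<alpha>) (dom_Ustar \<alpha>) x"
  define m :: 'n where "m = Max UNIV"
  define E where "E = (D m)\<^sup>2 * node_sign m * (\<Prod>l\<in>UNIV-{m}. node m - node l)"
  have "E > 0"
    using mult_pos_pos[OF zero_less_power[OF D[of m], of 2] node_sign_prod_pos[of m]]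
    by (simp add: E_def mult.assoc)
  then show "\<exists>C>0. \<forall>k. (D k)\<^sup>2 * node_sign k * (\<Prod>i\<in>UNIV-{k}. node k - node i) = 1 / C"
    using orthogonal_imp_weights[OF orth]
    by (intro exI[of _ "1 / E"]) (simp add: E_def m_def)
qed (use weights_imp_orthogonal in blast)

end

theorem proposition6p3:
  fixes \<alpha> :: "'n::{finite, linorder} \<Rightarrow> int"
    and D :: "'n \<Rightarrow> real"
    and x :: "real^('n::{finite, linorder}) \<Rightarrow> real^('n::{finite, linorder})"
  assumes N: "CARD('n) \<ge> 2"
    and \<alpha>: "\<And>i j. i < j \<Longrightarrow> \<alpha> i > \<alpha> j"
    and D: "\<And>k. D k > 0"
    and x: "\<And>n k. n \<in> dom_U \<alpha> \<union> dom_Ustar \<alpha> \<Longrightarrow>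
      x n $ k = D k *
        (\<Prod>i\<in>{..<k}. dsqrt (- n $ i - of_int (\<alpha> k) - (real (pos k) - real (pos i)) / 2 + 1/2)) *
        (\<Prod>i\<in>{k..}. dsqrt (n $ i + of_int (\<alpha> k) + (real (pos k) - real (pos i)) / 2))"
  shows "orthogonal_net (dom_U \<alpha>) (dom_Ustar \<alpha>) x \<longleftrightarrow>
    (\<exists>C>0. \<forall>k. D k powi (-2) = C *
      (\<Prod>i\<in>{..<k}. of_int (\<alpha> i) - of_int (\<alpha> k) + (real (pos i) - real (pos k)) / 2) *
      (\<Prod>i\<in>{k<..}. of_int (\<alpha> k) - of_int (\<alpha> i) + (real (pos k) - real (pos i)) / 2))"
proof -
  interpret dsqrt_net \<alpha> D x
    using \<alpha> D x by unfold_locales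
  show ?thesis
    \<comment> \<open>Regrouping to \<open>C\<close> times the two products lets
      \<open>node_prods_eq\<close> apply.\<close>
    unfolding orthogonal_net_iff mult.assoc[of _ "prod _ {..<_}"] node_prods_eq
    using powi_condition_iff by blast
qed

end
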